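(* There exist infinitely many Hermitian graphs (i.e., Hermitian matrices $H$) which admit perfect state transfer from some vertex $a$ to some vertex $b$ but are not periodic at $a$.
   Context: A Hermitian graph on vertex set $V$ is given by an arbitrary Hermitian matrix $H$ with rows and columns indexed by $V$ (no restriction on the entries). Its transition matrix is $U(t)=e^{-itH}$. There is perfect state transfer from $a$ to $b$ at time $\tau$ if $U(\tau)e_a=\alpha e_b$ for some $\alpha\in\mathbb{C}$ with $|\alpha|=1$, where $e_v$ is the standard basis vector of vertex $v$. The graph is periodic at $a$ if there is a time $\tau>0$ with $U(\tau)e_a=\alpha e_a$ for some $|\alpha|=1$. *)

theory Defs
  imports "Jordan_Normal_Form.Schur_Decomposition"
begin

text \<open>
  Finite vertex sets are taken to be \<open>{0..<n}\<close>, so that \<^typ>\<open>complex mat\<close>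
  contains the Hermitian graphs of every order.
\<close>

definition hermitian_graph :: "complex mat \<Rightarrow> bool" where
  "hermitian_graph H \<longleftrightarrow> square_mat H \<and> mat_adjoint H = H"

lemma hermitian_graph_iff:
  "hermitian_graph H \<longleftrightarrow>
     square_mat H \<and> (\<forall>i<dim_row H. \<forall>j<dim_row H. H $$ (j, i) = cnj (H $$ (i, j)))"
proof (cases "square_mat H")
  case True
  have entry: "mat_adjoint H $$ (j, i) = cnj (H $$ (i, j))"
    if "i < dim_row H" "j < dim_row H" for i j
    using that True by (simp add: mat_adjoint_def mat_of_rows_def)
  have dims: "dim_row (mat_adjoint H) = dim_row H" "dim_col (mat_adjoint H) = dim_row H"
    using True by (simp_all add: mat_adjoint_def)
  have "mat_adjoint H = H \<longleftrightarrow>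
      (\<forall>j<dim_row H. \<forall>i<dim_row H. mat_adjoint H $$ (j, i) = H $$ (j, i))"
    using True dims by (simp add: mat_eq_iff)
  also have "\<dots> \<longleftrightarrow> (\<forall>i<dim_row H. \<forall>j<dim_row H. H $$ (j, i) = cnj (H $$ (i, j)))"
    using entry by metis
  finally show ?thesis
    using True by (simp only: hermitian_graph_def)
qed (simp add: hermitian_graph_def)

text \<open>
  The entries of the exponential are those of the power series \<open>\<Sum>k. A ^ k / k!\<close>;
  \<open>mat_exp_sums\<close> below shows that it converges for every square matrix, so that
  \<^const>\<open>suminf\<close> has its intended meaning.
\<close>

definition mat_exp :: "complex mat \<Rightarrow> complex mat" where
  "mat_exp A = mat (dim_row A) (dim_col A) (\<lambda>(i, j). \<Sum>k. (A ^\<^sub>m k) $$ (i, j) / fact k)"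

lemma mat_exp_sums:
  assumes A: "A \<in> carrier_mat n n" and i: "i < n" and j: "j < n"
  shows "(\<lambda>k. (A ^\<^sub>m k) $$ (i, j) / fact k) sums (mat_exp A $$ (i, j))"
proof -
  define C where "C = (\<Sum>r<n. \<Sum>s<n. cmod (A $$ (r, s)))"
  have C0: "C \<ge> 0"
    unfolding C_def by (intro sum_nonneg) auto
  have AC: "cmod (A $$ (r, s)) \<le> C" if "r < n" "s < n" for r s
  proof -
    have "cmod (A $$ (r, s)) \<le> (\<Sum>s<n. cmod (A $$ (r, s)))"
      using that by (intro member_le_sum) auto
    also have "\<dots> \<le> C"
      unfolding C_def using that
      by (intro member_le_sum[where f = "\<lambda>r. \<Sum>s<n. cmod (A $$ (r, s))"] sum_nonneg) auto
    finally show ?thesis .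
  qed
  have bound: "cmod ((A ^\<^sub>m k) $$ (r, s)) \<le> (of_nat n * C) ^ k" if "r < n" "s < n" for k r s
    using that
  proof (induction k arbitrary: r s)
    case 0
    then show ?case using A by (auto simp: one_mat_def)
  next
    case (Suc k)
    have P: "A ^\<^sub>m k \<in> carrier_mat n n"
      using A by (rule pow_carrier_mat)
    have "(A ^\<^sub>m Suc k) $$ (r, s) = (\<Sum>l\<in>{0..<n}. (A ^\<^sub>m k) $$ (r, l) * A $$ (l, s))"
      using A P Suc.prems by (simp add: scalar_prod_def)
    also have "cmod \<dots> \<le> (\<Sum>l\<in>{0..<n}. (of_nat n * C) ^ k * C)"
      using Suc.prems C0
      by (intro order_trans[OF norm_sum] sum_mono)
         (auto simp: norm_mult intro!: mult_mono Suc.IH AC)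
    also have "\<dots> = (of_nat n * C) ^ Suc k"
      by simp
    finally show ?case .
  qed
  have "summable (\<lambda>k. (A ^\<^sub>m k) $$ (i, j) / fact k)"
  proof (rule summable_comparison_test'[where N = 0])
    show "summable (\<lambda>k. (of_nat n * C) ^ k / fact k)"
      using summable_exp[of "of_nat n * C"] by (simp add: divide_inverse mult.commute)
    show "norm ((A ^\<^sub>m k) $$ (i, j) / fact k) \<le> (of_nat n * C) ^ k / fact k" for k
      using bound[OF i j, of k] by (simp add: norm_divide divide_right_mono)
  qed
  then show ?thesis
    using A i j by (simp add: mat_exp_def summable_sums)
qed

definition transition_matrix :: "complex mat \<Rightarrow> real \<Rightarrow> complex mat" where
  "transition_matrix H t = mat_exp ((- \<i> * complex_of_real t) \<cdot>\<^sub>m H)"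

text \<open>
  \<open>perfect_state_transfer H a a 0\<close> always holds, so existence claims about
  transfer have to ask for \<open>a \<noteq> b\<close> or \<open>\<tau> > 0\<close> explicitly.
\<close>

definition perfect_state_transfer :: "complex mat \<Rightarrow> nat \<Rightarrow> nat \<Rightarrow> real \<Rightarrow> bool" where
  "perfect_state_transfer H a b \<tau> \<longleftrightarrow>
     (\<exists>\<alpha>. cmod \<alpha> = 1 \<and>
        transition_matrix H \<tau> *\<^sub>v unit_vec (dim_row H) a = \<alpha> \<cdot>\<^sub>v unit_vec (dim_row H) b)"

definition periodic_at :: "complex mat \<Rightarrow> nat \<Rightarrow> bool" where
  "periodic_at H a \<longleftrightarrow>
     (\<exists>\<tau>>0. \<exists>\<alpha>. cmod \<alpha> = 1 \<and>
        transition_matrix H \<tau> *\<^sub>v unit_vec (dim_row H) a = \<alpha> \<cdot>\<^sub>v unit_vec (dim_row H) a)"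

end

theory Submission
  imports Defs "HOL-Analysis.Continuum_Not_Denumerable"
begin

text \<open>
  Fix an irrational \<open>s\<close>. Choose a unit vector \<open>e\<^sub>0\<close> with equal components in four
  eigenspaces, of eigenvalues \<open>0, 1, s, 1 + s\<close>. At time \<open>\<pi>\<close> the four components acquire the
  phases \<open>1, -1, w, -w\<close> with \<open>w = cis (-\<pi> s)\<close>; as these sum to zero, the resulting vector is
  orthogonal to \<open>e\<^sub>0\<close> and may be taken as \<open>e\<^sub>1\<close>. A period \<open>t > 0\<close> would make both
  \<open>t / (2 \<pi>)\<close> and \<open>s t / (2 \<pi>)\<close> integers. The graphs for different \<open>s\<close> differ in the entry
  \<open>(1 + s) / 2\<close> at \<open>(0, 0)\<close>.
\<close>

text \<open>In \<open>u r i\<close> the first index numbers the eigenvector and the second the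
  vertex. This spectral form lets scalar factors, powers and exponentials act on \<theta>
  alone.\<close>

definition spectral_mat :: "nat \<Rightarrow> (nat \<Rightarrow> 'a::conjugatable_ring) \<Rightarrow> (nat \<Rightarrow> nat \<Rightarrow> 'a) \<Rightarrow> 'a mat" where
  "spectral_mat n \<theta> u = mat n n (\<lambda>(i, j). \<Sum>r<n. \<theta> r * u r i * conjugate (u r j))"

text \<open>Unitarity from both sides: the first conjunct collapses products of spectral sums, the
  second resolves the identity and gives the zeroth power.\<close>

definition orthonormal_basis :: "nat \<Rightarrow> (nat \<Rightarrow> nat \<Rightarrow> complex) \<Rightarrow> bool" where
  "orthonormal_basis n u \<longleftrightarrow>
     (\<forall>r<n. \<forall>s<n. (\<Sum>i<n. cnj (u r i) * u s i) = of_bool (r = s)) \<and>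
     (\<forall>i<n. \<forall>j<n. (\<Sum>r<n. u r i * cnj (u r j)) = of_bool (i = j))"

lemma spectral_mat_carrier [simp]: "spectral_mat n \<theta> u \<in> carrier_mat n n"
  by (simp add: spectral_mat_def)

lemma spectral_mat_dim [simp]:
  "dim_row (spectral_mat n \<theta> u) = n" "dim_col (spectral_mat n \<theta> u) = n"
  by (simp_all add: spectral_mat_def)

lemma spectral_mat_index:
  fixes \<theta> :: "nat \<Rightarrow> complex"
  shows "i < n \<Longrightarrow> j < n \<Longrightarrow> spectral_mat n \<theta> u $$ (i, j) = (\<Sum>r<n. \<theta> r * u r i * cnj (u r j))"
  by (simp add: spectral_mat_def)

lemma smult_spectral_mat:
  fixes \<theta> :: "nat \<Rightarrow> complex"
  shows "c \<cdot>\<^sub>m spectral_mat n \<theta> u = spectral_mat n (\<lambda>r. c * \<theta> r) u"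
  by (rule eq_matI) (simp_all add: spectral_mat_index sum_distrib_left mult.assoc)

text \<open>Each summand is a real multiple of a Hermitian matrix of the form v v*.\<close>

lemma hermitian_spectral_mat: "hermitian_graph (spectral_mat n (\<lambda>r. complex_of_real (\<theta> r)) u)"
  by (auto simp: hermitian_graph_iff spectral_mat_index intro!: sum.cong)

lemma pow_spectral_mat:
  assumes u: "orthonormal_basis n u"
  shows "spectral_mat n \<theta> u ^\<^sub>m k = spectral_mat n (\<lambda>r. \<theta> r ^ k) u"
proof (induction k)
  case 0
  show ?case
    using u by (auto intro!: eq_matI simp: spectral_mat_index orthonormal_basis_def)
next
  case (Suc k)
  show ?case
  proof (rule eq_matI)
    fix i j assume "i < dim_row (spectral_mat n (\<lambda>r. \<theta> r ^ Suc k) u)"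
      and "j < dim_col (spectral_mat n (\<lambda>r. \<theta> r ^ Suc k) u)"
    then have i: "i < n" and j: "j < n" by simp_all
    have "(spectral_mat n \<theta> u ^\<^sub>m Suc k) $$ (i, j) =
        (\<Sum>l<n. (\<Sum>r<n. \<theta> r ^ k * u r i * cnj (u r l)) * (\<Sum>s<n. \<theta> s * u s l * cnj (u s j)))"
      using i j by (simp add: Suc.IH scalar_prod_def spectral_mat_index atLeast0LessThan)
    \<comment> \<open>The factors containing \<open>l\<close> are collected so that the sum over
      \<open>l\<close>, once innermost, is the inner product of \<open>u r\<close> and
      \<open>u s\<close>.\<close>
    also have "\<dots> = (\<Sum>l<n. \<Sum>r<n. \<Sum>s<n. \<theta> r ^ k * u r i * \<theta> s * cnj (u s j) * (cnj (u r l) * u s l))"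
      unfolding sum_product by (intro sum.cong refl) (simp add: mult_ac)
    also have "\<dots> = (\<Sum>r<n. \<Sum>l<n. \<Sum>s<n. \<theta> r ^ k * u r i * \<theta> s * cnj (u s j) * (cnj (u r l) * u s l))"
      by (rule sum.swap)
    also have "\<dots> = (\<Sum>r<n. \<Sum>s<n. \<Sum>l<n. \<theta> r ^ k * u r i * \<theta> s * cnj (u s j) * (cnj (u r l) * u s l))"
      by (intro sum.cong refl sum.swap)
    also have "\<dots> = (\<Sum>r<n. \<Sum>s<n. \<theta> r ^ k * u r i * \<theta> s * cnj (u s j) * of_bool (r = s))"
      using u by (intro sum.cong refl) (simp add: sum_distrib_left [symmetric] orthonormal_basis_def)
    also have "\<dots> = (\<Sum>r<n. \<theta> r ^ Suc k * u r i * cnj (u r j))"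
      by (intro sum.cong refl) (simp add: of_bool_def if_distrib mult_ac cong: if_cong)
    finally show "(spectral_mat n \<theta> u ^\<^sub>m Suc k) $$ (i, j) =
        spectral_mat n (\<lambda>r. \<theta> r ^ Suc k) u $$ (i, j)"
      using i j by (simp add: spectral_mat_index)
  qed simp_all
qed

text \<open>Each entry of the power series is a finite combination of scalar exponential series; its
  limit is compared with the one from \<open>mat_exp_sums\<close>.\<close>

lemma mat_exp_spectral_mat:
  assumes u: "orthonormal_basis n u"
  shows "mat_exp (spectral_mat n \<theta> u) = spectral_mat n (\<lambda>r. exp (\<theta> r)) u"
proof (rule eq_matI)
  fix i j assume "i < dim_row (spectral_mat n (\<lambda>r. exp (\<theta> r)) u)"
    and "j < dim_col (spectral_mat n (\<lambda>r. exp (\<theta> r)) u)"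
  then have i: "i < n" and j: "j < n" by simp_all
  have "(\<lambda>k. \<Sum>r<n. (\<theta> r ^ k /\<^sub>R fact k) * (u r i * cnj (u r j))) sums
      (\<Sum>r<n. exp (\<theta> r) * (u r i * cnj (u r j)))"
    by (intro sums_sum sums_mult2 exp_converges)
  then have "(\<lambda>k. (spectral_mat n \<theta> u ^\<^sub>m k) $$ (i, j) / fact k) sums
      (spectral_mat n (\<lambda>r. exp (\<theta> r)) u $$ (i, j))"
    using i j by (simp add: pow_spectral_mat [OF u] spectral_mat_index sum_divide_distrib
        scaleR_conv_of_real field_simps)
  with mat_exp_sums [OF spectral_mat_carrier i j]
  show "mat_exp (spectral_mat n \<theta> u) $$ (i, j) = spectral_mat n (\<lambda>r. exp (\<theta> r)) u $$ (i, j)"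
    by (rule sums_unique2)
qed (simp_all add: mat_exp_def)

lemma transition_spectral_mat:
  assumes "orthonormal_basis n u"
  shows "transition_matrix (spectral_mat n (\<lambda>r. complex_of_real (\<theta> r)) u) t =
    spectral_mat n (\<lambda>r. cis (- t * \<theta> r)) u"
  by (simp add: transition_matrix_def smult_spectral_mat mat_exp_spectral_mat [OF assms] cis_conv_exp mult_ac)

text \<open>The coefficient of the \<open>a\<close>-th unit vector along \<open>u r\<close> is
  \<open>cnj (u r a)\<close>, and the transition matrix multiplies it by a phase, so one compares
  coefficients. The case \<open>b = a\<close> handles periodicity.\<close>

lemma transition_spectral_unit_vec_eq_iff:
  assumes u: "orthonormal_basis n u" and a: "a < n" and b: "b < n"
  shows "transition_matrix (spectral_mat n (\<lambda>r. complex_of_real (\<theta> r)) u) t *\<^sub>v unit_vec n a =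
      \<alpha> \<cdot>\<^sub>v unit_vec n b \<longleftrightarrow> (\<forall>r<n. cis (- t * \<theta> r) * cnj (u r a) = \<alpha> * cnj (u r b))"
    (is "?lhs \<longleftrightarrow> (\<forall>r<n. ?c r = _)")
proof -
  have "?lhs \<longleftrightarrow> (\<forall>i<n. (\<Sum>r<n. ?c r * u r i) = \<alpha> * of_bool (i = b))"
    using a b
    by (auto simp: transition_spectral_mat [OF u] vec_eq_iff mult_mat_vec_def scalar_prod_def unit_vec_def
        spectral_mat_index if_distrib mult_ac cong: if_cong)
  also have "\<dots> \<longleftrightarrow> (\<forall>r<n. ?c r = \<alpha> * cnj (u r b))"
  proof safe
    fix r assume r: "r < n" and *: "\<forall>i<n. (\<Sum>r<n. ?c r * u r i) = \<alpha> * of_bool (i = b)"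
    \<comment> \<open>The coefficient along \<open>u r\<close> is recovered by taking the inner
      product with \<open>u r\<close>.\<close>
    have "?c r = (\<Sum>s<n. ?c s * of_bool (r = s))"
      using r by (simp add: of_bool_def if_distrib cong: if_cong)
    also have "\<dots> = (\<Sum>s<n. ?c s * (\<Sum>i<n. cnj (u r i) * u s i))"
      using u r by (simp add: orthonormal_basis_def)
    also have "\<dots> = (\<Sum>s<n. \<Sum>i<n. cnj (u r i) * (?c s * u s i))"
      by (simp add: sum_distrib_left mult_ac)
    also have "\<dots> = (\<Sum>i<n. cnj (u r i) * (\<Sum>s<n. ?c s * u s i))"
      by (subst sum.swap) (simp add: sum_distrib_left)
    also have "\<dots> = (\<Sum>i<n. cnj (u r i) * (\<alpha> * of_bool (i = b)))"
      using * by (intro sum.cong refl) simp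
    also have "\<dots> = \<alpha> * cnj (u r b)"
      using b by (simp add: of_bool_def if_distrib mult_ac cong: if_cong)
    finally show "?c r = \<alpha> * cnj (u r b)" .
  next
    fix i assume i: "i < n" and *: "\<forall>r<n. ?c r = \<alpha> * cnj (u r b)"
    have "(\<Sum>r<n. ?c r * u r i) = \<alpha> * (\<Sum>r<n. u r i * cnj (u r b))"
      using * by (simp add: sum_distrib_left mult_ac)
    then show "(\<Sum>r<n. ?c r * u r i) = \<alpha> * of_bool (i = b)"
      using u i b by (simp add: orthonormal_basis_def)
  qed
  finally show ?thesis .
qed

definition pst_eigenvalue :: "real \<Rightarrow> nat \<Rightarrow> real" where
  "pst_eigenvalue s r = [0, 1, s, 1 + s] ! r"

text \<open>Rows are eigenvectors, columns are vertices. As coefficients are conjugated entries,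
  \<open>w\<close> here is the conjugate of the phase at time \<pi>. Columns 2 and 3 only complete
  columns 0 and 1 to a unitary matrix.\<close>

definition pst_eigenvector :: "real \<Rightarrow> nat \<Rightarrow> nat \<Rightarrow> complex" where
  "pst_eigenvector s r i = (let w = cis (pi * s) in
     [[1, 1, 1, 1], [1, - 1, - 1, 1], [1, w, - w, - 1], [1, - w, w, - 1]] ! r ! i / 2)"

definition pst_graph :: "real \<Rightarrow> complex mat" where
  "pst_graph s = spectral_mat 4 (\<lambda>r. complex_of_real (pst_eigenvalue s r)) (pst_eigenvector s)"

lemma all_less_4: "(\<forall>r<4. P r) \<longleftrightarrow> P 0 \<and> P 1 \<and> P 2 \<and> P (3::nat)"
  by (auto simp: numeral_eq_Suc All_less_Suc)

lemma sum_less_4: "(\<Sum>r<4. f r) = f 0 + f 1 + f 2 + f (3::nat)"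
  by (simp add: numeral_eq_Suc)

lemma orthonormal_pst_eigenvector: "orthonormal_basis 4 (pst_eigenvector s)"
  by (simp add: orthonormal_basis_def all_less_4 sum_less_4 pst_eigenvector_def Let_def
      cis_cnj cis_mult)

lemma pst_pst_graph: "perfect_state_transfer (pst_graph s) 0 1 pi"
proof -
  have "cis (- pi) = - 1" "cis (- pi - pi * s) = - cis (- (pi * s))"
    by (simp_all add: complex_eq_iff cos_diff sin_diff)
  \<comment> \<open>The factor is 1 because the component of eigenvalue 0 does not move and is the
    same for both vertices.\<close>
  then have "\<forall>r<4. cis (- pi * pst_eigenvalue s r) * cnj (pst_eigenvector s r 0) = 1 * cnj (pst_eigenvector s r 1)"
    by (simp add: all_less_4 pst_eigenvalue_def pst_eigenvector_def Let_def
      cis_cnj distrib_left)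
  then show ?thesis
    unfolding perfect_state_transfer_def pst_graph_def spectral_mat_dim
    by (intro exI [of _ 1] conjI
        transition_spectral_unit_vec_eq_iff [OF orthonormal_pst_eigenvector, THEN iffD2]) simp_all
qed

lemma not_periodic_pst_graph:
  assumes s: "s \<notin> \<rat>"
  shows "\<not> periodic_at (pst_graph s) 0"
proof
  assume "periodic_at (pst_graph s) 0"
  then obtain t \<alpha> where t: "t > 0"
    and "\<forall>r<4. cis (- t * pst_eigenvalue s r) * cnj (pst_eigenvector s r 0) =
      \<alpha> * cnj (pst_eigenvector s r 0)"
    unfolding periodic_at_def pst_graph_def spectral_mat_dim
    by (auto simp: transition_spectral_unit_vec_eq_iff [OF orthonormal_pst_eigenvector])
  \<comment> \<open>All coefficients of vertex 0 equal 1/2 and cancel. Eigenvalue 0 then forces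
    \<alpha> = 1, and the eigenvalues 1 and \<open>s\<close> give the two equations.\<close>
  then have "cis (- t) = 1" "cis (- (t * s)) = 1"
    by (simp_all add: all_less_4 pst_eigenvalue_def pst_eigenvector_def)
  then have "cos t = 1" "cos (t * s) = 1"
    by (simp_all add: complex_eq_iff)
  then obtain k l :: int where k: "t = of_int k * 2 * pi" and l: "t * s = of_int l * 2 * pi"
    unfolding cos_one_2pi_int by auto
  then have "k \<noteq> 0"
    using t by auto
  with k l have "s = of_int l / of_int k"
    by (simp add: field_simps)
  with s show False by (simp add: Rats_divide)
qed

lemma inj_pst_graph: "inj pst_graph"
proof (rule injI)
  fix s s' assume "pst_graph s = pst_graph s'"
  then have "pst_graph s $$ (0, 0) = pst_graph s' $$ (0, 0)" by simp
  then show "s = s'"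
    by (simp add: pst_graph_def spectral_mat_index sum_less_4 pst_eigenvalue_def
        pst_eigenvector_def field_simps)
qed

text \<open>Distinct vertices and a positive time exclude trivial transfer. All witnesses have order
  4, so infinitude comes from the parameter \<open>s\<close> and not from varying the order.\<close>

theorem theorem4p4:
  shows "infinite {H :: complex mat. hermitian_graph H \<and>
    (\<exists>a<dim_row H. \<exists>b<dim_row H. a \<noteq> b \<and>
      (\<exists>\<tau>>0. perfect_state_transfer H a b \<tau>) \<and> \<not> periodic_at H a)}"
    (is "infinite ?S")
proof (rule infinite_super)
  show "pst_graph ` (UNIV - \<rat>) \<subseteq> ?S"
  proof safe
    fix s :: real assume s: "s \<notin> \<rat>"
    show "hermitian_graph (pst_graph s)"
      by (simp add: pst_graph_def hermitian_spectral_mat)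
    have "0 < dim_row (pst_graph s)" "1 < dim_row (pst_graph s)"
      by (simp_all add: pst_graph_def)
    then show "\<exists>a<dim_row (pst_graph s). \<exists>b<dim_row (pst_graph s). a \<noteq> b \<and>
      (\<exists>\<tau>>0. perfect_state_transfer (pst_graph s) a b \<tau>) \<and> \<not> periodic_at (pst_graph s) a"
      using pst_pst_graph [of s] not_periodic_pst_graph [OF s] pi_gt_zero zero_neq_one by blast
  qed
  have "uncountable (UNIV - \<rat> :: real set)"
    by (intro uncountable_minus_countable uncountable_UNIV_real countable_rat)
  then show "infinite (pst_graph ` (UNIV - \<rat>))"
    using inj_pst_graph by (simp add: finite_image_iff inj_on_subset uncountable_infinite)
qed

end
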